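(* Let $M$ be a left-cancellative monoid with no nontrivial invertible element and let $S$ be a Garside family in $M$. Let $(S,R)$ be the associated rewriting system, $R=\{s|t\to N^S(s|t)\mid s,t\in S,\ s|t\neq N^S(s|t)\}$. Then $(S,R)$ is terminating. More precisely, every rewriting sequence starting from an $S$-word of length $p$ has length (number of rewriting steps) at most $2^p-p-1$.
   Context: In a monoid $M$, $f\preccurlyeq g$ (left-divisibility) means $\exists g'\in M\ (fg'=g)$. An $S$-word $s_1|\cdots|s_p$ (finite sequence of elements of $S\subseteq M$) represents the element $s_1\cdots s_p$ of $M$. For $M$ left-cancellative and $S\subseteq M$, a length-two $S$-word $s_1|s_2$ is $S$-normal if $\forall s\in S\ \forall f\in M\ (s\preccurlyeq f s_1 s_2 \Rightarrow s\preccurlyeq f s_1)$. An $S$-word $s_1|\cdots|s_p$ is $S$-normal if $s_i|s_{i+1}$ is $S$-normal for every $i<p$. For $M$ left-cancellative with no nontrivial invertible element, a subset $S$ of $M$ containing $1$ is a Garside family in $M$ if every element $g$ of $M$ has an $S$-normal decomposition, that is, there is an $S$-normal $S$-word $s_1|\cdots|s_p$ with $s_1\cdots s_p=g$. In this case, for every $S$-word $w$ there is a unique $S$-normal word of the same length representing the same element of $M$; it is denoted $N^S(w)$. A rewriting step of $(S,R)$ replaces a factor of an $S$-word equal to the left-hand side of a rule of $R$ by its right-hand side; $S$-words are elements of the free monoid on the set $S$, in which the element $1\in S$ is treated as an ordinary letter. *)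

theory Defs
  imports Main
begin

(* The monoid M is the whole of a type of class monoid_mult; the words over S are the elements
   of "lists S", and a word w represents "prod_list w". *)

definition left_divides :: "'a::monoid_mult \<Rightarrow> 'a \<Rightarrow> bool"
  where "left_divides f g \<longleftrightarrow> (\<exists>g'. f * g' = g)"

definition invertible :: "'a::monoid_mult \<Rightarrow> bool"
  where "invertible a \<longleftrightarrow> (\<exists>b. a * b = 1 \<and> b * a = 1)"

definition normal_pair :: "'a::monoid_mult set \<Rightarrow> 'a \<Rightarrow> 'a \<Rightarrow> bool"
  where "normal_pair S s\<^sub>1 s\<^sub>2 \<longleftrightarrow>
    (\<forall>s\<in>S. \<forall>f. left_divides s (f * s\<^sub>1 * s\<^sub>2) \<longrightarrow> left_divides s (f * s\<^sub>1))"

(* Words of length 0 and 1 are normal. *)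
definition normal_word :: "'a::monoid_mult set \<Rightarrow> 'a list \<Rightarrow> bool"
  where "normal_word S w \<longleftrightarrow>
    w \<in> lists S \<and> (\<forall>i. Suc i < length w \<longrightarrow> normal_pair S (w ! i) (w ! Suc i))"

(* Meant for left-cancellative monoids without nontrivial invertible elements. *)
definition garside_family :: "'a::monoid_mult set \<Rightarrow> bool"
  where "garside_family S \<longleftrightarrow>
    1 \<in> S \<and> (\<forall>g. \<exists>w. normal_word S w \<and> prod_list w = g)"

(* Existence and uniqueness hold whenever S is a Garside family and w is a word over S. *)
definition normal_form :: "'a::monoid_mult set \<Rightarrow> 'a list \<Rightarrow> 'a list"
  where "normal_form S w =
    (THE v. normal_word S v \<and> length v = length w \<and> prod_list v = prod_list w)"

definition garside_rules :: "'a::monoid_mult set \<Rightarrow> ('a list \<times> 'a list) set"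
  where "garside_rules S =
    {([s, t], normal_form S [s, t]) | s t. s \<in> S \<and> t \<in> S \<and> [s, t] \<noteq> normal_form S [s, t]}"

definition rewrite_step :: "'a set \<Rightarrow> ('a list \<times> 'a list) set \<Rightarrow> ('a list \<times> 'a list) set"
  where "rewrite_step S R =
    {(u @ l @ v, u @ r @ v) | u l r v. u \<in> lists S \<and> v \<in> lists S \<and> (l, r) \<in> R}"

definition terminating :: "'a set \<Rightarrow> ('a list \<times> 'a list) set \<Rightarrow> bool"
  where "terminating S R \<longleftrightarrow>
    \<not> (\<exists>w :: nat \<Rightarrow> 'a list. w 0 \<in> lists S \<and> (\<forall>i. (w i, w (Suc i)) \<in> rewrite_step S R))"

end

theory Submission imports Defs begin

text \<open>
  Let \<open>g\<^sub>k\<close> be the product of the first \<open>k\<close> letters of a word of length \<open>p\<close>. A rewriting step replaces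
  one \<open>g\<^sub>k\<close> by the greatest element of \<open>g\<^sub>k\<^sub>-\<^sub>1S\<close> dividing \<open>g\<^sub>k\<^sub>+\<^sub>1\<close>. Attach to \<open>g\<^sub>0, \<dots>, g\<^sub>p\<^sub>-\<^sub>1\<close> counters
  \<open>c\<^sub>0, \<dots>, c\<^sub>p\<^sub>-\<^sub>1\<close>, initially zero, and let a step at \<open>g\<^sub>k\<close> perform \<open>(c\<^sub>k\<^sub>-\<^sub>1, c\<^sub>k) := (c\<^sub>k, c\<^sub>k + 1)\<close>. One
  maintains that \<open>c\<^sub>0 = 0\<close>, that \<open>c\<^sub>k\<^sub>+\<^sub>1 \<le> c\<^sub>k + 1\<close>, and that \<open>g\<^sub>j\<^sub>+\<^sub>1\<close> is the greatest element of \<open>g\<^sub>jS\<close>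
  dividing \<open>g\<^sub>k\<close> whenever \<open>c\<^sub>i > c\<^sub>j\<close> for all \<open>i\<close> with \<open>j < i < k\<close>. The last condition makes a step at
  \<open>g\<^sub>k\<close> impossible if \<open>c\<^sub>k\<^sub>-\<^sub>1 < c\<^sub>k\<close>, and otherwise the step decreases the sum of the \<open>2\<^sup>k / 2\<^sup>c\<close> with
  \<open>c = c\<^sub>k\<close>. This sum is \<open>2\<^sup>p - 1\<close> at the beginning and at least \<open>p\<close> at any time.
\<close>

section \<open>Left divisors and heads of normal words\<close>

lemma left_divides_refl: "left_divides a a"
  unfolding left_divides_def by (rule exI[of _ 1]) simp

lemma left_divides_trans: "left_divides a b \<Longrightarrow> left_divides b c \<Longrightarrow> left_divides a c"
  unfolding left_divides_def by (metis mult.assoc)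

lemma left_divides_mult_right: "left_divides a (a * b)"
  unfolding left_divides_def by blast

lemma left_divides_prod_list_take:
  "j \<le> k \<Longrightarrow> left_divides (prod_list (take j w)) (prod_list (take k w))"
  by (metis left_divides_mult_right le_add_diff_inverse prod_list.append take_add)

lemma normal_word_Cons_Cons:
  "normal_word S (a # b # v) \<longleftrightarrow> a \<in> S \<and> normal_pair S a b \<and> normal_word S (b # v)"
proof -
  have split: "(\<forall>i. P i) \<longleftrightarrow> P 0 \<and> (\<forall>i. P (Suc i))" for P :: "nat \<Rightarrow> bool"
    by (auto intro: nat_induct)
  show ?thesis
    unfolding normal_word_def by (subst split) auto
qed

lemma normal_word_singleton: "normal_word S [a] \<longleftrightarrow> a \<in> S"
  unfolding normal_word_def by simp

lemma normal_pair_one_right: "normal_pair S a 1"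
  unfolding normal_pair_def by simp

text \<open>Induction along the word: with \<open>f * v\<close> in place of \<open>f\<close>, the
  tail shrinks to its first letter \<open>u\<close>, which normality of \<open>v|u\<close> then
  removes.\<close>

lemma left_divides_normal_word_head:
  assumes "normal_word S (v # vs)" and "t \<in> S" and "left_divides t (f * prod_list (v # vs))"
  shows "left_divides t (f * v)"
  using assms
proof (induction vs arbitrary: v f)
  case Nil
  then show ?case by simp
next
  case (Cons u us)
  have "normal_word S (u # us)" and "left_divides t (f * v * prod_list (u # us))"
    using Cons.prems by (auto simp: normal_word_Cons_Cons mult.assoc)
  then have "left_divides t (f * v * u)"
    using Cons.IH Cons.prems(2) by blast
  then show ?case
    using Cons.prems by (auto simp: normal_word_Cons_Cons normal_pair_def)
qed

section \<open>Greatest divisors of a prescribed form\<close>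

text \<open>
  Quantifying over all left divisors \<open>a\<^sub>0\<close> of \<open>a\<close>, and not only over \<open>a\<close>, encodes the universally
  quantified factor \<open>f\<close> of \<open>normal_pair\<close>.
\<close>
definition greedy_top :: "'a::monoid_mult set \<Rightarrow> 'a \<Rightarrow> 'a \<Rightarrow> 'a \<Rightarrow> bool"
  where "greedy_top S a b e \<longleftrightarrow>
    (\<exists>s\<in>S. e = a * s) \<and> left_divides e b \<and>
    (\<forall>a\<^sub>0. \<forall>t\<in>S. left_divides a\<^sub>0 a \<longrightarrow> left_divides (a\<^sub>0 * t) b \<longrightarrow> left_divides (a\<^sub>0 * t) e)"

lemma greedy_top_self: "s \<in> S \<Longrightarrow> greedy_top S a (a * s) (a * s)"
  unfolding greedy_top_def by (auto intro: left_divides_refl)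

text \<open>A left divisor of \<open>a\<close> also divides \<open>a'\<close>, so the candidates
  \<open>a\<^sub>0 * t\<close> dividing \<open>b\<close> are exactly those dividing
  \<open>e\<close>. This carries greediness between near and far products.\<close>

lemma greedy_top_cong:
  assumes "left_divides a a'" and "greedy_top S a' b e"
  shows "greedy_top S a e x \<longleftrightarrow> greedy_top S a b x"
proof
  assume x: "greedy_top S a e x"
  show "greedy_top S a b x"
    unfolding greedy_top_def
  proof (intro conjI allI ballI impI)
    show "\<exists>s\<in>S. x = a * s"
      using x unfolding greedy_top_def by blast
    show "left_divides x b"
      using x assms(2) left_divides_trans unfolding greedy_top_def by blast
    fix a\<^sub>0 t
    assume t: "t \<in> S" "left_divides a\<^sub>0 a" "left_divides (a\<^sub>0 * t) b"
    then have "left_divides (a\<^sub>0 * t) e"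
      using assms left_divides_trans unfolding greedy_top_def by blast
    then show "left_divides (a\<^sub>0 * t) x"
      using x t unfolding greedy_top_def by blast
  qed
next
  assume x: "greedy_top S a b x"
  then obtain s where s: "s \<in> S" "x = a * s" "left_divides x b"
    unfolding greedy_top_def by blast
  then have "left_divides x e"
    using assms unfolding greedy_top_def by blast
  moreover have "left_divides e b"
    using assms(2) unfolding greedy_top_def by blast
  ultimately show "greedy_top S a e x"
    using x left_divides_trans unfolding greedy_top_def by blast
qed

section \<open>The potential and its decrease\<close>

text \<open>
  The potential is evaluated only where \<open>c j \<le> j\<close>, so the subtraction is not truncated.
\<close>
definition potential :: "nat \<Rightarrow> (nat \<Rightarrow> nat) \<Rightarrow> nat"
  where "potential n c = (\<Sum>j<n. 2 ^ (j - c j))"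

lemma potential_ge: "n \<le> potential n c"
proof -
  have "(\<Sum>j<n. 1) \<le> potential n c"
    unfolding potential_def by (rule sum_mono) simp
  then show ?thesis by simp
qed

lemma potential_zero: "potential n (\<lambda>_. 0) = 2 ^ n - 1"
  unfolding potential_def by (induction n) (auto simp: algebra_simps)

text \<open>The two new terms are equal and add up to the old term at \<open>Suc m\<close>, so the
  sum drops by the old term at \<open>m\<close>.\<close>

lemma potential_step:
  assumes "Suc m < n" and "c (Suc m) \<le> c m" and "c m \<le> m"
  shows "potential n (c(m := c (Suc m), Suc m := Suc (c (Suc m)))) < potential n c"
proof -
  let ?c' = "c(m := c (Suc m), Suc m := Suc (c (Suc m)))"
  let ?R = "{..<n} - {m, Suc m}"
  have split: "potential n d = 2 ^ (m - d m) + 2 ^ (Suc m - d (Suc m)) + (\<Sum>j\<in>?R. 2 ^ (j - d j))" for d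
  proof -
    have "{..<n} = insert m (insert (Suc m) ?R)"
      using assms(1) by auto
    then have "potential n d = (\<Sum>j\<in>insert m (insert (Suc m) ?R). 2 ^ (j - d j))"
      unfolding potential_def by simp
    then show ?thesis by simp
  qed
  have "(\<Sum>j\<in>?R. 2 ^ (j - ?c' j)) = (\<Sum>j\<in>?R. 2 ^ (j - c j) :: nat)"
    by (rule sum.cong) auto
  moreover have "(2::nat) ^ (Suc m - c (Suc m)) = 2 * 2 ^ (m - c (Suc m))"
    using assms by (simp add: Suc_diff_le)
  ultimately show ?thesis
    unfolding split by simp
qed

section \<open>Normal forms of two-letter words\<close>

locale garside_monoid =
  fixes S :: "'a::monoid_mult set"
  assumes left_cancel: "\<And>a b c :: 'a. a * b = a * c \<Longrightarrow> b = c"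
    and no_invertible: "\<And>a :: 'a. invertible a \<Longrightarrow> a = 1"
    and garside: "garside_family S"
begin

text \<open>By left cancellation a right inverse is also a left inverse.\<close>

lemma mult_eq_one: "a * b = 1 \<Longrightarrow> a = 1 \<and> b = (1::'a)"
proof -
  assume ab: "a * b = 1"
  then have "a * (b * a) = a * 1"
    by (simp flip: mult.assoc)
  then have "b * a = 1"
    by (rule left_cancel)
  with ab show ?thesis
    using no_invertible unfolding invertible_def by metis
qed

lemma left_divides_antisym:
  assumes "left_divides a b" and "left_divides b (a::'a)"
  shows "a = b"
proof -
  obtain x y where x: "a * x = b" and y: "b * y = a"
    using assms unfolding left_divides_def by blast
  have "a * (x * y) = a * 1"
    using y by (simp add: x flip: mult.assoc)
  then have "x = 1"
    using left_cancel mult_eq_one by blast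
  then show ?thesis
    using x by simp
qed

lemma left_divides_cancel:
  assumes "left_divides (a * b) (a * c)"
  shows "left_divides b (c::'a)"
proof -
  obtain x where "a * (b * x) = a * c"
    using assms unfolding left_divides_def by (auto simp: mult.assoc)
  then have "b * x = c"
    by (rule left_cancel)
  then show ?thesis
    unfolding left_divides_def by blast
qed

lemma greedy_top_unique:
  assumes "greedy_top S a b e" and "greedy_top S a b e'"
  shows "e = e'"
proof -
  have "left_divides x y" if x: "greedy_top S a b x" and y: "greedy_top S a b y" for x y
  proof -
    obtain s where "s \<in> S" "x = a * s" "left_divides x b"
      using x unfolding greedy_top_def by blast
    then show ?thesis
      using y left_divides_refl unfolding greedy_top_def by blast
  qed
  then show ?thesis
    using assms left_divides_antisym by blast
qed

text \<open>Once \<open>a\<^sub>0\<close> is cancelled, the cofactor of \<open>a\<^sub>0\<close> in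
  \<open>a\<close> serves as the arbitrary factor \<open>f\<close> of
  \<open>normal_pair\<close>.\<close>

lemma normal_pair_greedy_top:
  assumes "s \<in> S" and "normal_pair S s t"
  shows "greedy_top S a (a * s * t) (a * s)"
  unfolding greedy_top_def
proof (intro conjI allI ballI impI)
  fix a\<^sub>0 x
  assume x: "x \<in> S" and "left_divides a\<^sub>0 a" and d: "left_divides (a\<^sub>0 * x) (a * s * t)"
  then obtain f where a: "a = a\<^sub>0 * f"
    unfolding left_divides_def by blast
  have "left_divides x (f * s * t)"
    using d unfolding a by (auto simp: mult.assoc intro: left_divides_cancel)
  then have "left_divides x (f * s)"
    using assms(2) x unfolding normal_pair_def by blast
  then show "left_divides (a\<^sub>0 * x) (a * s)"
    unfolding a left_divides_def by (metis mult.assoc)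
qed (use assms(1) in \<open>auto intro: left_divides_mult_right\<close>)

text \<open>A normal decomposition may have any length: short ones are padded with \<open>1\<close>,
  and in long ones the letters after the second multiply to \<open>1\<close>.\<close>

lemma ex_normal_pair:
  assumes s: "s \<in> S" and t: "t \<in> S"
  shows "\<exists>a b. normal_word S [a, b] \<and> a * b = s * t"
proof -
  obtain w where w: "normal_word S w" "prod_list w = s * t" and one: "1 \<in> S"
    using garside unfolding garside_family_def by blast
  consider "w = []" | a where "w = [a]" | a b v where "w = a # b # v"
    by (metis list.exhaust)
  then show ?thesis
  proof cases
    case 1
    then show ?thesis
      using w one by (intro exI[of _ 1]) (auto simp: normal_word_Cons_Cons normal_word_singleton normal_pair_one_right)
  next
    case 2
    then show ?thesis
      using w one by (intro exI[of _ a] exI[of _ 1]) (auto simp: normal_word_Cons_Cons normal_word_singleton normal_pair_one_right)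
  next
    case 3
    \<comment> \<open>The head property is used for \<open>s\<close>, then for \<open>t\<close>
      after cancelling \<open>s\<close>; this makes \<open>prod_list v\<close> a factor of
      \<open>1\<close>.\<close>
    have "left_divides s (1 * a)"
      using w(1) s unfolding 3
      by (rule left_divides_normal_word_head) (use w(2) in \<open>auto simp: 3 intro: left_divides_mult_right\<close>)
    then obtain x where a: "a = s * x"
      unfolding left_divides_def by auto
    have "s * (x * (b * prod_list v)) = s * t"
      using w(2) unfolding 3 a by (simp add: mult.assoc)
    then have eq: "x * (b * prod_list v) = t"
      by (rule left_cancel)
    have "normal_word S (b # v)"
      using w(1) unfolding 3 normal_word_Cons_Cons by simp
    then have "left_divides t (x * b)"
      by (rule left_divides_normal_word_head[OF _ t]) (simp add: eq left_divides_refl)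
    then obtain y where y: "t * y = x * b"
      unfolding left_divides_def by blast
    have "t * (y * prod_list v) = t * 1"
      using eq by (simp add: y flip: mult.assoc)
    then have "prod_list v = 1"
      using left_cancel mult_eq_one by blast
    then show ?thesis
      using w unfolding 3
      by (intro exI[of _ a] exI[of _ b])
        (auto simp: normal_word_Cons_Cons normal_word_singleton normal_word_def)
  qed
qed

lemma normal_pair_unique:
  assumes "normal_word S [a, b]" and "normal_word S [a', b']" and eq: "a * b = a' * b'"
  shows "a = a' \<and> b = b'"
proof -
  have "greedy_top S 1 (1 * a * b) (1 * a)" "greedy_top S 1 (1 * a' * b') (1 * a')"
    using assms(1,2) unfolding normal_word_Cons_Cons by (blast intro: normal_pair_greedy_top)+
  then have "a = a'"
    using eq greedy_top_unique by simp
  then show ?thesis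
    using eq left_cancel by blast
qed

lemma normal_form_pairE:
  assumes "s \<in> S" and "t \<in> S"
  obtains a b where "normal_form S [s, t] = [a, b]" and "a \<in> S" and "b \<in> S"
    and "normal_pair S a b" and "a * b = s * t"
proof -
  obtain a b where ab: "normal_word S [a, b]" "a * b = s * t"
    using ex_normal_pair[OF assms] by blast
  have "normal_form S [s, t] = [a, b]"
    unfolding normal_form_def
  proof (rule the_equality)
    fix v
    assume v: "normal_word S v \<and> length v = length [s, t] \<and> prod_list v = prod_list [s, t]"
    then obtain a' b' where "v = [a', b']"
      by (auto simp: length_Suc_conv)
    then show "v = [a, b]"
      using v ab normal_pair_unique[of a' b' a b] by simp
  qed (use ab in simp)
  then show thesis
    using ab that by (auto simp: normal_word_Cons_Cons normal_word_singleton)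
qed

section \<open>The counter invariant under rewriting\<close>

definition counters :: "'a list \<Rightarrow> (nat \<Rightarrow> nat) \<Rightarrow> bool"
  where "counters w c \<longleftrightarrow>
    c 0 = 0 \<and> (\<forall>k. c (Suc k) \<le> Suc (c k)) \<and>
    (\<forall>j k. j < k \<longrightarrow> k \<le> length w \<longrightarrow> (\<forall>i. j < i \<longrightarrow> i < k \<longrightarrow> c j < c i) \<longrightarrow>
      greedy_top S (prod_list (take j w)) (prod_list (take k w)) (prod_list (take (Suc j) w)))"

lemma counters_le: "counters w c \<Longrightarrow> c k \<le> k"
  unfolding counters_def by (induction k) (auto intro: le_trans)

lemma greedy_top_take_Suc:
  assumes "w \<in> lists S" and "j < length w"
  shows "greedy_top S (prod_list (take j w)) (prod_list (take (Suc j) w)) (prod_list (take (Suc j) w))"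
  using assms greedy_top_self[of "w ! j" S "prod_list (take j w)"]
  by (auto simp: take_Suc_conv_app_nth)

text \<open>Equal counters never exceed one another, so only the trivial case
  \<open>k = Suc j\<close> remains.\<close>

lemma counters_zero:
  assumes "w \<in> lists S"
  shows "counters w (\<lambda>_. 0)"
  unfolding counters_def
proof (intro conjI allI impI)
  fix j k
  assume "j < k" "k \<le> length w" "\<forall>i. j < i \<longrightarrow> i < k \<longrightarrow> (0::nat) < 0"
  then have "k = Suc j"
    by (metis Suc_lessI lessI less_irrefl)
  then show "greedy_top S (prod_list (take j w)) (prod_list (take k w)) (prod_list (take (Suc j) w))"
    using assms \<open>k \<le> length w\<close> greedy_top_take_Suc by simp
qed simp_all

lemma counters_step:
  assumes step: "(w, w') \<in> rewrite_step S (garside_rules S)"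
    and w: "w \<in> lists S" and inv: "counters w c"
  obtains c' where "w' \<in> lists S" and "length w' = length w" and "counters w' c'"
    and "potential (length w) c' < potential (length w) c"
proof -
  obtain u v s t where wd: "w = u @ [s, t] @ v" "w' = u @ normal_form S [s, t] @ v"
    and uv: "u \<in> lists S" "v \<in> lists S" and st: "s \<in> S" "t \<in> S"
    and ne: "[s, t] \<noteq> normal_form S [s, t]"
    using step unfolding rewrite_step_def garside_rules_def by blast
  obtain a b where nf: "normal_form S [s, t] = [a, b]" and ab: "a \<in> S" "b \<in> S"
    and np: "normal_pair S a b" and eq: "a * b = s * t"
    using normal_form_pairE[OF st] .
  define m where "m = length u"
  define g where "g k = prod_list (take k w)" for k
  define g' where "g' k = prod_list (take k w')" for k
  have w': "w' \<in> lists S" and len: "length w' = length w" and m: "Suc m < length w"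
    using wd nf uv ab by (auto simp: m_def)
  have g'_eq: "g' k = g k" if "k \<noteq> Suc m" for k
  proof (cases "k \<le> m")
    case True
    then show ?thesis
      unfolding g_def g'_def wd m_def by simp
  next
    case False
    then have "k - m = Suc (Suc (k - m - 2))"
      using that by simp
    then show ?thesis
      unfolding g_def g'_def wd nf using False eq
      by (simp add: m_def flip: mult.assoc)
  qed
  have gm: "g m = prod_list u" "g (Suc m) = prod_list u * s" "g (Suc (Suc m)) = prod_list u * s * t"
    "g' (Suc m) = prod_list u * a"
    unfolding g_def g'_def wd nf m_def by (simp_all add: mult.assoc)
  have top: "greedy_top S (g m) (g (Suc (Suc m))) (g' (Suc m))"
    using normal_pair_greedy_top[OF ab(1) np, of "prod_list u"] eq unfolding gm
    by (simp add: mult.assoc)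
  have changed: "g' (Suc m) \<noteq> g (Suc m)"
  proof
    assume "g' (Suc m) = g (Suc m)"
    then have "a = s"
      unfolding gm by (rule left_cancel)
    then show False
      using eq left_cancel ne nf by metis
  qed
  have c0: "c 0 = 0" and cS: "\<And>k. c (Suc k) \<le> Suc (c k)"
    and cg: "\<And>j k. \<lbrakk>j < k; k \<le> length w; \<And>i. \<lbrakk>j < i; i < k\<rbrakk> \<Longrightarrow> c j < c i\<rbrakk>
      \<Longrightarrow> greedy_top S (g j) (g k) (g (Suc j))"
    using inv unfolding counters_def g_def by blast+
  \<comment> \<open>Otherwise the invariant for \<open>j = m\<close>, \<open>k = Suc (Suc m)\<close>
    makes \<open>g (Suc m)\<close> greedy already, and the step would change nothing.\<close>
  have le: "c (Suc m) \<le> c m"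
  proof (rule ccontr)
    assume "\<not> c (Suc m) \<le> c m"
    then have "greedy_top S (g m) (g (Suc (Suc m))) (g (Suc m))"
      using m by (intro cg) (auto simp: less_Suc_eq)
    then show False
      using top changed greedy_top_unique by blast
  qed
  define c' where "c' = c(m := c (Suc m), Suc m := Suc (c (Suc m)))"
  have c'_m: "c' m = c (Suc m)" "c' (Suc m) = Suc (c (Suc m))"
    and c'_eq: "\<And>i. i \<noteq> m \<Longrightarrow> i \<noteq> Suc m \<Longrightarrow> c' i = c i"
    unfolding c'_def by auto
  have g_mono: "left_divides (g i) (g k)" if "i \<le> k" for i k
    unfolding g_def using that by (rule left_divides_prod_list_take)
  have "counters w' c'"
    unfolding counters_def len g'_def[symmetric]
  proof (intro conjI allI impI)
    show "c' 0 = 0"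
      using c0 le by (cases m) (auto simp: c'_def)
    show "c' (Suc k) \<le> Suc (c' k)" for k
      using le cS[of k] by (auto simp: c'_def)
  next
    fix j k
    assume jk: "j < k" "k \<le> length w" and "\<forall>i. j < i \<longrightarrow> i < k \<longrightarrow> c' j < c' i"
    then have gt: "\<And>i. \<lbrakk>j < i; i < k\<rbrakk> \<Longrightarrow> c' j < c' i"
      by blast
    show "greedy_top S (g' j) (g' k) (g' (Suc j))"
    proof (cases "k = Suc j")
      case True
      then show ?thesis
        using greedy_top_take_Suc[OF w'] jk len unfolding g'_def by simp
    next
      case False
      with jk have jk': "Suc j < k"
        by simp
      \<comment> \<open>The only changed product enters the goal as \<open>g' j\<close>,
        \<open>g' (Suc j)\<close>, \<open>g' k\<close>, or not at all.\<close>
      consider "j = Suc m" | "j = m" | "j \<noteq> m" "j \<noteq> Suc m" "k = Suc m"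
        | "j \<noteq> m" "j \<noteq> Suc m" "k \<noteq> Suc m"
        by blast
      then show ?thesis
      proof cases
        \<comment> \<open>This case is vacuous: after the increment at \<open>Suc m\<close>, the
          next counter cannot be larger, since \<open>c\<close> rises by at most one.\<close>
        case 1
        then have "Suc (c (Suc m)) < c (Suc (Suc m))"
          using gt[of "Suc (Suc m)"] jk' c'_m c'_eq[of "Suc (Suc m)"] by simp
        then show ?thesis
          using cS[of "Suc m"] by simp
      next
        \<comment> \<open>As \<open>c' m\<close> is the old counter at \<open>Suc m\<close>, the old
          invariant starting at \<open>Suc m\<close> applies and lets \<open>top\<close> extend from
          \<open>g (Suc (Suc m))\<close> to \<open>g k\<close>.\<close>
        case 2
        have "greedy_top S (g m) (g k) (g' (Suc m))"
        proof (cases "k = Suc (Suc m)")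
          case True
          then show ?thesis
            using top by simp
        next
          case False
          have "greedy_top S (g (Suc m)) (g k) (g (Suc (Suc m)))"
          proof (rule cg)
            fix i
            assume "Suc m < i" "i < k"
            then show "c (Suc m) < c i"
              using gt[of i] 2 c'_m c'_eq[of i] by simp
          qed (use jk jk' 2 False in auto)
          then show ?thesis
            using top greedy_top_cong[OF g_mono[of m "Suc m"]] by simp
        qed
        then show ?thesis
          using 2 jk' g'_eq[of m] g'_eq[of k] by simp
      next
        \<comment> \<open>As \<open>c j < c' m = c (Suc m)\<close>, the old invariant reaches one
          index further, to \<open>Suc (Suc m)\<close>; \<open>top\<close> brings it back to
          \<open>g' (Suc m)\<close>.\<close>
        case 3
        with jk' have jm: "Suc j \<le> m"
          by simp
        have "greedy_top S (g j) (g (Suc (Suc m))) (g (Suc j))"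
        proof (rule cg)
          fix i
          assume i: "j < i" "i < Suc (Suc m)"
          have "c j < c (Suc m)"
            using gt[of m] 3 jm c'_m c'_eq[of j] by simp
          moreover have "c j < c i" if "i < m"
            using gt[of i] 3 i that c'_eq[of i] c'_eq[of j] by simp
          ultimately show "c j < c i"
            using i le by (auto simp: less_Suc_eq)
        qed (use jm m in auto)
        then have "greedy_top S (g j) (g' (Suc m)) (g (Suc j))"
          using greedy_top_cong[OF g_mono[of j m] top] jm by simp
        then show ?thesis
          using 3 jm g'_eq[of j] g'_eq[of "Suc j"] by simp
      next
        case 4
        have "greedy_top S (g j) (g k) (g (Suc j))"
        proof (rule cg)
          fix i
          assume i: "j < i" "i < k"
          have "c j < c' i"
            using gt[OF i] 4 c'_eq[of j] by simp
          \<comment> \<open>At \<open>Suc m\<close> the new counter is one too large, so the bound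
            comes from \<open>c' m\<close>, the old counter there; \<open>m\<close> lies after
            \<open>j\<close> because \<open>j \<noteq> m\<close>.\<close>
          moreover have "c j < c' m" if "i = Suc m"
            using gt[of m] i 4 that c'_eq[of j] by simp
          ultimately show "c j < c i"
            using le c'_m c'_eq[of i] by (cases "i = m \<or> i = Suc m") auto
        qed (use jk in auto)
        then show ?thesis
          using 4 g'_eq[of j] g'_eq[of k] g'_eq[of "Suc j"] by simp
      qed
    qed
  qed
  moreover have "potential (length w) c' < potential (length w) c"
    unfolding c'_def using m le counters_le[OF inv] by (intro potential_step)
  ultimately show thesis
    using that w' len by blast
qed

section \<open>The step bound and termination\<close>

lemma relpow_rewrite_step_counters:
  assumes "w \<in> lists S" and "(w, w') \<in> rewrite_step S (garside_rules S) ^^ n"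
  shows "\<exists>c. w' \<in> lists S \<and> length w' = length w \<and> counters w' c \<and>
    n + potential (length w) c \<le> 2 ^ length w - 1"
  using assms(2)
proof (induction n arbitrary: w')
  case 0
  then show ?case
    using assms(1) counters_zero by (intro exI[of _ "\<lambda>_. 0"]) (auto simp: potential_zero)
next
  case (Suc n)
  then obtain v where v: "(w, v) \<in> rewrite_step S (garside_rules S) ^^ n"
    and step: "(v, w') \<in> rewrite_step S (garside_rules S)"
    by auto
  obtain c where c: "v \<in> lists S" "length v = length w" "counters v c"
    "n + potential (length w) c \<le> 2 ^ length w - 1"
    using Suc.IH[OF v] by blast
  obtain c' where "w' \<in> lists S" "length w' = length v" "counters w' c'"
    "potential (length v) c' < potential (length v) c"
    using counters_step[OF step c(1,3)] .
  then show ?case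
    using c by (intro exI[of _ c']) auto
qed

text \<open>The potential left at the end accounts for \<open>length w\<close>. The additive form
  avoids truncated subtraction.\<close>

lemma relpow_rewrite_step_bound:
  assumes "w \<in> lists S" and "(w, w') \<in> rewrite_step S (garside_rules S) ^^ n"
  shows "n + length w + 1 \<le> 2 ^ length w"
proof -
  obtain c where "n + potential (length w) c \<le> 2 ^ length w - 1"
    using relpow_rewrite_step_counters[OF assms] by blast
  moreover have "(1::nat) \<le> 2 ^ length w"
    by simp
  ultimately show ?thesis
    using potential_ge[of "length w" c] by linarith
qed

lemma terminating_garside_rules: "terminating S (garside_rules S)"
  unfolding terminating_def
proof
  assume "\<exists>w. w 0 \<in> lists S \<and> (\<forall>i. (w i, w (Suc i)) \<in> rewrite_step S (garside_rules S))"
  then obtain w where w: "w 0 \<in> lists S" "\<And>i. (w i, w (Suc i)) \<in> rewrite_step S (garside_rules S)"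
    by blast
  have "(w 0, w n) \<in> rewrite_step S (garside_rules S) ^^ n" for n
    by (induction n) (auto intro: w)
  \<comment> \<open>Taking \<open>n = 2 ^ length (w 0)\<close> exceeds the bound.\<close>
  then have "2 ^ length (w 0) + length (w 0) + 1 \<le> (2::nat) ^ length (w 0)"
    using relpow_rewrite_step_bound[OF w(1)] by blast
  then show False
    by simp
qed

end

theorem corollary4p35:
  fixes S :: "'a::monoid_mult set"
  assumes left_cancel: "\<And>a b c :: 'a. a * b = a * c \<Longrightarrow> b = c"
    and no_invertible: "\<And>a :: 'a. invertible a \<Longrightarrow> a = 1"
    and garside: "garside_family S"
  shows "terminating S (garside_rules S) \<and>
    (\<forall>p n w w'. w \<in> lists S \<and> length w = p \<and> (w, w') \<in> rewrite_step S (garside_rules S) ^^ n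
      \<longrightarrow> int n \<le> 2 ^ p - int p - 1)"
proof -
  interpret garside_monoid S
    using assms by unfold_locales
  have "int n \<le> 2 ^ length w - int (length w) - 1"
    if "w \<in> lists S" "(w, w') \<in> rewrite_step S (garside_rules S) ^^ n" for n w w'
  proof -
    have "int (n + length w + 1) \<le> int (2 ^ length w)"
      using relpow_rewrite_step_bound[OF that] by (simp only: of_nat_le_iff)
    then show ?thesis
      by simp
  qed
  then show ?thesis
    using terminating_garside_rules by blast
qed

end
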